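(* Let $w_1,w_2,w_3$ be any odd positive integers. Then for every integer $n\ge 0$ and all $y_1,y_2\in\mathbb{Z}_p$, the following six expressions are equal: \begin{align*} &\sum_{k+l+m=n}\binom{n}{k,l,m}E_{k,\chi}(w_1y_1)E_{l,\chi}(w_2y_2)T_m(w_3d-1,\chi)\,w_{1}^{l+m}w_{2}^{k+m}w_{3}^{k+l}\\ =&\sum_{k+l+m=n}\binom{n}{k,l,m}E_{k,\chi}(w_1y_1)E_{l,\chi}(w_3y_2)T_m(w_2d-1,\chi)\,w_{1}^{l+m}w_{3}^{k+m}w_{2}^{k+l}\\ =&\sum_{k+l+m=n}\binom{n}{k,l,m}E_{k,\chi}(w_2y_1)E_{l,\chi}(w_1y_2)T_m(w_3d-1,\chi)\,w_{2}^{l+m}w_{1}^{k+m}w_{3}^{k+l}\\ =&\sum_{k+l+m=n}\binom{n}{k,l,m}E_{k,\chi}(w_2y_1)E_{l,\chi}(w_3y_2)T_m(w_1d-1,\chi)\,w_{2}^{l+m}w_{3}^{k+m}w_{1}^{k+l}\\ =&\sum_{k+l+m=n}\binom{n}{k,l,m}E_{k,\chi}(w_3y_1)E_{l,\chi}(w_2y_2)T_m(w_1d-1,\chi)\,w_{3}^{l+m}w_{2}^{k+m}w_{1}^{k+l}\\ =&\sum_{k+l+m=n}\binom{n}{k,l,m}E_{k,\chi}(w_3y_1)E_{l,\chi}(w_1y_2)T_m(w_2d-1,\chi)\,w_{3}^{l+m}w_{1}^{k+m}w_{2}^{k+l}. \end{align*} Here each sum is over all nonnegative integers $k,l,m$ with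 $k+l+m=n$.
   Context: $p$ is a fixed odd prime, $\mathbb{Z}_p$ is the ring of $p$-adic integers, and $\mathbb{C}_p$ is the completion of an algebraic closure of $\mathbb{Q}_p$. $d$ is a fixed odd positive integer and $\chi$ is a (primitive) Dirichlet character of conductor $d$, with values in $\overline{\mathbb{Q}}$, regarded as $\mathbb{C}_p$-valued through a fixed embedding $\overline{\mathbb{Q}}\to\mathbb{C}_p$; as usual $\chi(a)=0$ when $\gcd(a,d)>1$ (and $\chi\equiv 1$ if $d=1$). The generalized Euler polynomials $E_{n,\chi}(x)$ attached to $\chi$ are the polynomials in $x$ defined by $$\frac{2e^{xt}}{e^{dt}+1}\sum_{a=0}^{d-1}(-1)^a\chi(a)e^{at}=\sum_{n=0}^{\infty}E_{n,\chi}(x)\frac{t^n}{n!}.$$ For integers $k,n\ge 0$, the $k$th alternating generalized power sum attached to $\chi$ is $T_k(n,\chi)=\sum_{a=0}^{n}(-1)^a\chi(a)a^k$, with the convention $0^0=1$. The multinomial coefficient is $\binom{n}{k,l,m}=\frac{n!}{k!\,l!\,m!}$. *)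

theory Defs
  imports
    "HOL-Analysis.Abstract_Metric_Spaces"
    "HOL-Computational_Algebra.Computational_Algebra"
begin

section \<open>The field \<open>\<complex>\<^sub>p\<close>\<close>

text \<open>
  The libraries provide no p-adic numbers, and a type cannot depend on the number \<open>p\<close>. So
  \<open>\<complex>\<^sub>p\<close> is given by its definition "completion of an algebraic closure of \<open>\<rat>\<^sub>p\<close>", which
  determines it up to isometric isomorphism: it is a type \<open>'c\<close> with an absolute value \<open>N\<close>, and
  \<open>\<rat>\<^sub>p\<close>, \<open>\<int>\<^sub>p\<close> and the algebraic closure of \<open>\<rat>\<^sub>p\<close> are subsets of that type.
\<close>

definition nonarch_absolute_value :: "('c::field \<Rightarrow> real) \<Rightarrow> bool" where
  "nonarch_absolute_value N \<longleftrightarrow>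
     (\<forall>x. N x \<ge> 0) \<and> (\<forall>x. N x = 0 \<longleftrightarrow> x = 0) \<and>
     (\<forall>x y. N (x * y) = N x * N y) \<and>
     (\<forall>x y. N (x + y) \<le> max (N x) (N y))"

definition abs_dist :: "('c::field \<Rightarrow> real) \<Rightarrow> 'c \<Rightarrow> 'c \<Rightarrow> real" where
  "abs_dist N x y = N (x - y)"

definition abs_closure :: "('c::field \<Rightarrow> real) \<Rightarrow> 'c set \<Rightarrow> 'c set" where
  "abs_closure N S = Metric_space.mtopology UNIV (abs_dist N) closure_of S"

text \<open>
  In a complete field whose absolute value restricts to the p-adic one on \<open>\<rat>\<close>, the closure of
  \<open>\<rat>\<close> is the p-adic completion of \<open>\<rat>\<close>.
\<close>

definition Q_p :: "('c::field_char_0 \<Rightarrow> real) \<Rightarrow> 'c set" where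
  "Q_p N = abs_closure N \<rat>"

definition Z_p :: "('c::field_char_0 \<Rightarrow> real) \<Rightarrow> 'c set" where
  "Z_p N = {x \<in> Q_p N. N x \<le> 1}"

definition Q_p_bar :: "('c::field_char_0 \<Rightarrow> real) \<Rightarrow> 'c set" where
  "Q_p_bar N = {x. \<exists>f. f \<noteq> 0 \<and> (\<forall>i. coeff f i \<in> Q_p N) \<and> poly f x = 0}"

locale C_p =
  fixes p :: nat and N :: "'c::field_char_0 \<Rightarrow> real"
  assumes prime_p: "prime p"
    and absolute_value: "nonarch_absolute_value N"
    and extends_p_adic:
      "\<And>m::int. m \<noteq> 0 \<Longrightarrow> N (of_int m) = 1 / real p ^ multiplicity (int p) m"
    and Q_p_bar_alg_closed:
      "\<And>f. degree f > 0 \<Longrightarrow> (\<forall>i. coeff f i \<in> Q_p_bar N) \<Longrightarrow> \<exists>x\<in>Q_p_bar N. poly f x = 0"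
    and Q_p_bar_dense: "abs_closure N (Q_p_bar N) = UNIV"
    and complete: "Metric_space.mcomplete UNIV (abs_dist N)"


section \<open>Dirichlet characters\<close>

definition dirichlet_character :: "nat \<Rightarrow> (int \<Rightarrow> complex) \<Rightarrow> bool" where
  "dirichlet_character d chi \<longleftrightarrow>
     d > 0 \<and> (\<forall>a b. chi (a * b) = chi a * chi b) \<and> (\<forall>a. chi (a + int d) = chi a) \<and>
     (\<forall>a. chi a \<noteq> 0 \<longleftrightarrow> coprime a (int d))"

definition conductor :: "nat \<Rightarrow> (int \<Rightarrow> complex) \<Rightarrow> nat" where
  "conductor d chi = (LEAST m. m dvd d \<and>
     (\<exists>\<psi>. dirichlet_character m \<psi> \<and> (\<forall>a. coprime a (int d) \<longrightarrow> chi a = \<psi> a)))"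

definition primitive_character :: "nat \<Rightarrow> (int \<Rightarrow> complex) \<Rightarrow> bool" where
  "primitive_character d chi \<longleftrightarrow> dirichlet_character d chi \<and> conductor d chi = d"

definition Q_bar :: "complex set" where
  "Q_bar = {z. algebraic z}"

text \<open>Only the values on \<open>Q_bar\<close> matter.\<close>

definition Q_bar_embedding :: "(complex \<Rightarrow> 'c::field_char_0) \<Rightarrow> bool" where
  "Q_bar_embedding \<iota> \<longleftrightarrow> inj_on \<iota> Q_bar \<and> \<iota> 1 = 1 \<and>
     (\<forall>x\<in>Q_bar. \<forall>y\<in>Q_bar. \<iota> (x + y) = \<iota> x + \<iota> y \<and> \<iota> (x * y) = \<iota> x * \<iota> y)"


section \<open>Generalized Euler polynomials and alternating power sums\<close>

text \<open>The generating function at \<open>x = 0\<close>.\<close>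

definition euler_gf0 :: "nat \<Rightarrow> (int \<Rightarrow> 'c::field_char_0) \<Rightarrow> 'c fps" where
  "euler_gf0 d chi =
     2 / (fps_exp (of_nat d) + 1) *
       (\<Sum>a<d. fps_const ((-1) ^ a * chi (int a)) * fps_exp (of_nat a))"

text \<open>
  The generating function is a power series in \<open>t\<close> over the polynomial ring in \<open>x\<close>. Its factor
  \<open>exp (x t)\<close> has the coefficients \<open>x ^ n / n!\<close>, and the other factor has constant polynomials
  as coefficients.
\<close>

definition gen_euler_poly :: "nat \<Rightarrow> (int \<Rightarrow> 'c::field_char_0) \<Rightarrow> nat \<Rightarrow> 'c poly" where
  "gen_euler_poly d chi n =
     smult (fact n)
       (fps_nth (Abs_fps (\<lambda>n. monom (1 / fact n) n) * Abs_fps (\<lambda>n. [:fps_nth (euler_gf0 d chi) n:])) n)"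

lemma gen_euler_poly_generating_function:
  fixes chi :: "int \<Rightarrow> 'c::field_char_0"
  shows "2 * fps_exp x / (fps_exp (of_nat d) + 1) *
           (\<Sum>a<d. fps_const ((-1) ^ a * chi (int a)) * fps_exp (of_nat a)) =
         Abs_fps (\<lambda>n. poly (gen_euler_poly d chi n) x / fact n)"
proof -
  let ?S = "\<Sum>a<d. fps_const ((-1) ^ a * chi (int a)) * fps_exp (of_nat a)"
  have u: "fps_nth (fps_exp (of_nat d) + 1 :: 'c fps) 0 \<noteq> 0"
    by simp
  have "2 * fps_exp x / (fps_exp (of_nat d) + 1) * ?S = fps_exp x * euler_gf0 d chi"
    by (simp only: euler_gf0_def fps_divide_unit[OF u] mult_ac)
  also have "\<dots> = Abs_fps (\<lambda>n. poly (gen_euler_poly d chi n) x / fact n)"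
    by (rule fps_ext)
      (simp add: gen_euler_poly_def fps_mult_nth[of "fps_exp x"] fps_mult_nth[of "Abs_fps _"]
        poly_sum poly_monom mult.commute[of "fps_nth (euler_gf0 d chi) _"])
  finally show ?thesis .
qed

definition alt_power_sum :: "(int \<Rightarrow> 'c::field_char_0) \<Rightarrow> nat \<Rightarrow> nat \<Rightarrow> 'c" where
  "alt_power_sum chi k n = (\<Sum>a=0..n. (-1) ^ a * chi (int a) * of_nat a ^ k)"

definition trinomial :: "nat \<Rightarrow> nat \<Rightarrow> nat \<Rightarrow> nat \<Rightarrow> 'c::field_char_0" where
  "trinomial n k l m = fact n / (fact k * fact l * fact m)"

end

theory Submission
  imports Defs
begin

text \<open>
  Let \<open>G(t)\<close> be the generating function at \<open>x = 0\<close> and \<open>W = w1 w2 w3\<close>. Periodicity of \<open>\<chi>\<close> and a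
  geometric sum show that the power sums up to \<open>w d - 1\<close> have the exponential generating function
  \<open>(1 + exp (w d t)) G(t) / 2\<close>. Hence the first of the six sums is \<open>n!\<close> times the \<open>n\<close>-th coefficient of
  \<open>exp (W (y1 + y2) t) G(w2 w3 t) G(w1 w3 t) G(w1 w2 t) (1 + exp (d W t)) / 2\<close>,
  which is symmetric in \<open>w1, w2, w3\<close>.
\<close>

text \<open>A threefold Cauchy product: the factorials below the trinomial coefficient are the
  denominators of the three exponential generating functions, which leaves \<open>fact n\<close>
  outside.\<close>

lemma trinomial_sum_eq_fps_nth:
  fixes a b c :: "nat \<Rightarrow> 'c::field_char_0"
  shows "(\<Sum>(k, l, m) \<in> {(k, l, m). k + l + m = n}. trinomial n k l m * a k * b l * c m) =
    fact n * fps_nth (Abs_fps (\<lambda>k. a k / fact k) * Abs_fps (\<lambda>k. b k / fact k) *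
      Abs_fps (\<lambda>k. c k / fact k)) n"
proof -
  let ?f = "\<lambda>k l m. trinomial n k l m * a k * b l * c m"
  have "(\<Sum>(k, l, m) \<in> {(k, l, m). k + l + m = n}. ?f k l m) =
      (\<Sum>(i, k) \<in> (SIGMA i:{0..n}. {0..i}). ?f k (i - k) (n - i))"
    \<comment> \<open>The index \<open>i = k + l\<close> is that of the outer Cauchy product, so
      \<open>l = i - k\<close> and \<open>m = n - i\<close>.\<close>
    by (rule sum.reindex_bij_witness[of _ "\<lambda>(i, k). (k, i - k, n - i)" "\<lambda>(k, l, m). (k + l, k)"]) auto
  also have "\<dots> = (\<Sum>i=0..n. \<Sum>k=0..i. ?f k (i - k) (n - i))"
    by (rule sum.Sigma[symmetric]) auto
  finally show ?thesis
    unfolding fps_mult_nth by (simp add: sum_distrib_left sum_distrib_right trinomial_def mult_ac)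
qed

text \<open>Substituting \<open>c t\<close> for \<open>t\<close> in the defining generating function
  absorbs the weight \<open>c ^ n\<close>.\<close>

lemma gen_euler_poly_scaled_gf:
  fixes chi :: "int \<Rightarrow> 'c::field_char_0"
  shows "Abs_fps (\<lambda>n. poly (gen_euler_poly d chi n) x * c ^ n / fact n) =
    fps_exp (x * c) * (euler_gf0 d chi oo (fps_const c * fps_X))"
proof -
  have u: "fps_nth (fps_exp (of_nat d) + 1 :: 'c fps) 0 \<noteq> 0"
    by simp
  have "Abs_fps (\<lambda>n. poly (gen_euler_poly d chi n) x / fact n) = fps_exp x * euler_gf0 d chi"
    unfolding gen_euler_poly_generating_function[symmetric]
    by (simp only: euler_gf0_def fps_divide_unit[OF u] mult_ac)
  then have "Abs_fps (\<lambda>n. poly (gen_euler_poly d chi n) x / fact n) oo (fps_const c * fps_X) =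
      (fps_exp x oo (fps_const c * fps_X)) * (euler_gf0 d chi oo (fps_const c * fps_X))"
    by (simp add: fps_compose_mult_distrib)
  then show ?thesis
    unfolding fps_compose_linear[of "Abs_fps _"]
    by (simp add: mult.commute[of x c] mult.commute[of "poly _ _"])
qed

text \<open>The character sum in the numerator of \<open>euler_gf0\<close>, with a free upper limit
  \<open>n\<close> in place of \<open>d\<close> and with \<open>c t\<close> in place of
  \<open>t\<close>.\<close>

definition char_exp_sum :: "(int \<Rightarrow> 'c::field_char_0) \<Rightarrow> nat \<Rightarrow> 'c \<Rightarrow> 'c fps" where
  "char_exp_sum chi n c = (\<Sum>a<n. fps_const ((-1) ^ a * chi (int a)) * fps_exp (of_nat a * c))"

lemma alt_power_sum_gf:
  fixes chi :: "int \<Rightarrow> 'c::field_char_0"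
  assumes "n > 0"
  shows "Abs_fps (\<lambda>m. alt_power_sum chi m (n - 1) * c ^ m / fact m) = char_exp_sum chi n c"
proof -
  \<comment> \<open>This fails for \<open>n = 0\<close>: truncated subtraction would keep the term
    at \<open>0\<close>.\<close>
  have "{0..n - 1} = {..<n}"
    using assms by auto
  then show ?thesis
    by (intro fps_ext)
      (simp add: alt_power_sum_def char_exp_sum_def fps_sum_nth sum_distrib_left
        sum_distrib_right sum_divide_distrib power_mult_distrib mult_ac)
qed

text \<open>Cut the range into \<open>w\<close> blocks of length \<open>d\<close>. Each block is
  \<open>- exp (d c t)\<close> times the one before, so this is a finite geometric sum with its
  denominator cleared. The sign \<open>(- 1) ^ w\<close> stays general because the induction passes
  through both parities of \<open>w\<close>.\<close>

lemma char_exp_sum_mult: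
  fixes chi :: "int \<Rightarrow> 'c::field_char_0"
  assumes per: "\<And>a. chi (a + int d) = chi a" and "odd d"
  shows "(fps_exp (of_nat d * c) + 1) * char_exp_sum chi (w * d) c =
    (1 - (- 1) ^ w * fps_exp (of_nat (w * d) * c)) * char_exp_sum chi d c"
proof (induction w)
  case 0
  then show ?case by (simp add: char_exp_sum_def)
next
  case (Suc w)
  have chi_shift: "chi (int (w * d + a)) = chi (int a)" for a
  proof (induction w)
    case (Suc w)
    then show ?case
      using per[of "int (w * d + a)"] by (simp add: algebra_simps)
  qed simp
  \<comment> \<open>Since \<open>d\<close> is odd, shifting by \<open>w\<close> blocks contributes
    exactly the sign \<open>(- 1) ^ w\<close>.\<close>
  have sign: "(- 1 :: 'c) ^ (w * d + a) = (- 1) ^ w * (- 1) ^ a" for a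
    using \<open>odd d\<close> by (simp add: power_add power_mult mult.commute[of w])
  have const: "fps_const ((- 1 :: 'c) ^ w) = (- 1) ^ w"
    by (simp flip: fps_const_power)
  have split: "sum f {..<m + k} = sum f {..<m} + (\<Sum>a<k. f (m + a))" for f :: "nat \<Rightarrow> 'c fps" and m k
    by (induction k) (simp_all add: add.assoc)
  have "char_exp_sum chi (Suc w * d) c = char_exp_sum chi (w * d) c +
      (\<Sum>a<d. fps_const ((- 1) ^ (w * d + a) * chi (int (w * d + a))) *
        fps_exp (of_nat (w * d + a) * c))"
    unfolding char_exp_sum_def mult_Suc add.commute[of d] by (rule split)
  also have "(\<Sum>a<d. fps_const ((- 1) ^ (w * d + a) * chi (int (w * d + a))) *
        fps_exp (of_nat (w * d + a) * c)) =
      (- 1) ^ w * fps_exp (of_nat (w * d) * c) * char_exp_sum chi d c"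
    unfolding chi_shift sign char_exp_sum_def sum_distrib_left const[symmetric]
    by (rule sum.cong)
      (simp_all add: distrib_left distrib_right fps_exp_add_mult mult_ac flip: fps_const_mult)
  finally have step: "char_exp_sum chi (Suc w * d) c = char_exp_sum chi (w * d) c +
      (- 1) ^ w * fps_exp (of_nat (w * d) * c) * char_exp_sum chi d c" .
  have exp_Suc: "fps_exp (of_nat (Suc w * d) * c) = fps_exp (of_nat d * c) * fps_exp (of_nat (w * d) * c)"
    by (simp add: distrib_right fps_exp_add_mult)
  show ?case
    unfolding step distrib_left Suc.IH exp_Suc by (simp add: algebra_simps)
qed

lemma euler_gf0_scaled:
  fixes chi :: "int \<Rightarrow> 'c::field_char_0"
  shows "(fps_exp (of_nat d * c) + 1) * (euler_gf0 d chi oo (fps_const c * fps_X)) =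
    2 * char_exp_sum chi d c"
proof -
  let ?X = "fps_const c * fps_X"
  have u: "fps_nth (fps_exp (of_nat d) + 1 :: 'c fps) 0 \<noteq> 0"
    by simp
  \<comment> \<open>The denominator is cleared before substituting \<open>c t\<close>, so that only
    sums and products have to be composed.\<close>
  have "(fps_exp (of_nat d) + 1) * euler_gf0 d chi = 2 * char_exp_sum chi d 1"
    unfolding euler_gf0_def char_exp_sum_def fps_divide_unit[OF u]
    using inverse_mult_eq_1[OF u] by (simp add: mult_ac)
  then have "((fps_exp (of_nat d) + 1) * euler_gf0 d chi) oo ?X = (2 * char_exp_sum chi d 1) oo ?X"
    by simp
  then show ?thesis
    by (simp add: fps_compose_mult_distrib fps_compose_add_distrib char_exp_sum_def
        fps_compose_sum_distrib mult.commute[of _ c])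
qed

text \<open>Multiplied by \<open>exp (d c t) + 1\<close>, both sides become the same multiple of
  \<open>char_exp_sum chi d c\<close>. Odd \<open>w\<close> turns the factor
  \<open>1 - (- 1) ^ w * exp (w d c t)\<close> into \<open>1 + exp (w d c t)\<close>.\<close>

lemma char_exp_sum_eq_euler_gf0:
  fixes chi :: "int \<Rightarrow> 'c::field_char_0"
  assumes "\<And>a. chi (a + int d) = chi a" and "odd d" and "odd w"
  shows "char_exp_sum chi (w * d) c =
    fps_const (1 / 2) * (1 + fps_exp (of_nat (w * d) * c)) * (euler_gf0 d chi oo (fps_const c * fps_X))"
    (is "?P = _ * ?R * ?G")
proof -
  let ?D = "fps_exp (of_nat d * c) + 1 :: 'c fps"
  \<comment> \<open>The constant term is \<open>2\<close>, nonzero in characteristic zero. Power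
    series over a field have no zero divisors, so \<open>?D\<close> can be cancelled below.\<close>
  have "fps_nth ?D 0 \<noteq> 0"
    by simp
  then have D: "?D \<noteq> 0"
    by (metis fps_zero_nth)
  have "?D * (2 * ?P) = 2 * (?R * char_exp_sum chi d c)"
    using char_exp_sum_mult[of chi d c w] assms by (simp add: mult_ac)
  also have "\<dots> = ?D * (?R * ?G)"
    using euler_gf0_scaled[of d c chi] by (simp add: mult_ac)
  finally have P: "2 * ?P = ?R * ?G"
    using D by simp
  have "fps_const (1 / 2 :: 'c) * 2 = 1"
    by (simp flip: numeral_fps_const)
  then have "?P = fps_const (1 / 2) * (2 * ?P)"
    by (simp flip: mult.assoc)
  then show ?thesis
    unfolding P by (simp only: mult.assoc)
qed

text \<open>The weights regroup as \<open>(v w) ^ k (u w) ^ l (u v) ^ m\<close>, which rescales the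
  three generating functions separately. Then \<open>y1\<close>, \<open>y2\<close> and
  \<open>d\<close> all meet the full product \<open>u v w\<close>, and permuting
  \<open>u, v, w\<close> only permutes commuting factors.\<close>

lemma trinomial_sum_eq_gf:
  fixes chi :: "int \<Rightarrow> 'c::field_char_0" and u v w :: nat
  assumes per: "\<And>a. chi (a + int d) = chi a" and "odd d" and "odd w"
  defines "G \<equiv> \<lambda>c. euler_gf0 d chi oo (fps_const (of_nat c) * fps_X)"
  shows "(\<Sum>(k, l, m) \<in> {(k, l, m). k + l + m = n}.
      trinomial n k l m * poly (gen_euler_poly d chi k) (of_nat u * y1) *
      poly (gen_euler_poly d chi l) (of_nat v * y2) * alt_power_sum chi m (w * d - 1) *
      of_nat u ^ (l + m) * of_nat v ^ (k + m) * of_nat w ^ (k + l)) =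
    fact n * fps_nth
      (fps_exp (of_nat (u * v * w) * y1) * fps_exp (of_nat (u * v * w) * y2) * fps_const (1 / 2) *
       (1 + fps_exp (of_nat (u * v * w * d))) * (G (v * w) * G (u * w) * G (u * v))) n"
proof -
  have pos: "w * d > 0"
    using \<open>odd d\<close> \<open>odd w\<close> by (auto intro: Nat.gr0I)
  have "(\<Sum>(k, l, m) \<in> {(k, l, m). k + l + m = n}.
      trinomial n k l m * poly (gen_euler_poly d chi k) (of_nat u * y1) *
      poly (gen_euler_poly d chi l) (of_nat v * y2) * alt_power_sum chi m (w * d - 1) *
      of_nat u ^ (l + m) * of_nat v ^ (k + m) * of_nat w ^ (k + l)) =
    (\<Sum>(k, l, m) \<in> {(k, l, m). k + l + m = n}. trinomial n k l m *
      (poly (gen_euler_poly d chi k) (of_nat u * y1) * of_nat (v * w) ^ k) *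
      (poly (gen_euler_poly d chi l) (of_nat v * y2) * of_nat (u * w) ^ l) *
      (alt_power_sum chi m (w * d - 1) * of_nat (u * v) ^ m))"
    by (intro sum.cong) (auto simp: power_add power_mult_distrib mult_ac)
  also have "\<dots> = fact n * fps_nth
      (fps_exp (of_nat u * y1 * of_nat (v * w)) * G (v * w) *
       (fps_exp (of_nat v * y2 * of_nat (u * w)) * G (u * w)) *
       (fps_const (1 / 2) * (1 + fps_exp (of_nat (w * d) * of_nat (u * v))) * G (u * v))) n"
    unfolding trinomial_sum_eq_fps_nth gen_euler_poly_scaled_gf alt_power_sum_gf[OF pos]
      char_exp_sum_eq_euler_gf0[where chi = chi, OF per \<open>odd d\<close> \<open>odd w\<close>] G_def ..
  finally show ?thesis
    by (simp only: of_nat_mult mult_ac)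
qed

theorem theorem4p2:
  fixes p d w1 w2 w3 n :: nat
    and N :: "'c::field_char_0 \<Rightarrow> real"
    and \<iota> :: "complex \<Rightarrow> 'c"
    and chi :: "int \<Rightarrow> complex"
    and y1 y2 :: 'c
  assumes "C_p p N" and "odd p"
    and "odd d"
    and "primitive_character d chi" and "range chi \<subseteq> Q_bar"
    and "Q_bar_embedding \<iota>"
    and "odd w1" and "odd w2" and "odd w3"
    and "y1 \<in> Z_p N" and "y2 \<in> Z_p N"
  shows
    "let E = (\<lambda>k x. poly (gen_euler_poly d (\<iota> \<circ> chi) k) x);
         T = alt_power_sum (\<iota> \<circ> chi);
         S = (\<Sum>(k, l, m) \<in> {(k, l, m). k + l + m = n}.
          trinomial n k l m * E k (of_nat w1 * y1) * E l (of_nat w2 * y2) * T m (w3 * d - 1) *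
          of_nat w1 ^ (l + m) * of_nat w2 ^ (k + m) * of_nat w3 ^ (k + l))
     in
        S = (\<Sum>(k, l, m) \<in> {(k, l, m). k + l + m = n}.
          trinomial n k l m * E k (of_nat w1 * y1) * E l (of_nat w3 * y2) * T m (w2 * d - 1) *
          of_nat w1 ^ (l + m) * of_nat w3 ^ (k + m) * of_nat w2 ^ (k + l)) \<and>
        S = (\<Sum>(k, l, m) \<in> {(k, l, m). k + l + m = n}.
          trinomial n k l m * E k (of_nat w2 * y1) * E l (of_nat w1 * y2) * T m (w3 * d - 1) *
          of_nat w2 ^ (l + m) * of_nat w1 ^ (k + m) * of_nat w3 ^ (k + l)) \<and>
        S = (\<Sum>(k, l, m) \<in> {(k, l, m). k + l + m = n}.
          trinomial n k l m * E k (of_nat w2 * y1) * E l (of_nat w3 * y2) * T m (w1 * d - 1) *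
          of_nat w2 ^ (l + m) * of_nat w3 ^ (k + m) * of_nat w1 ^ (k + l)) \<and>
        S = (\<Sum>(k, l, m) \<in> {(k, l, m). k + l + m = n}.
          trinomial n k l m * E k (of_nat w3 * y1) * E l (of_nat w2 * y2) * T m (w1 * d - 1) *
          of_nat w3 ^ (l + m) * of_nat w2 ^ (k + m) * of_nat w1 ^ (k + l)) \<and>
        S = (\<Sum>(k, l, m) \<in> {(k, l, m). k + l + m = n}.
          trinomial n k l m * E k (of_nat w3 * y1) * E l (of_nat w1 * y2) * T m (w2 * d - 1) *
          of_nat w3 ^ (l + m) * of_nat w1 ^ (k + m) * of_nat w2 ^ (k + l))"
proof -
  have per: "(\<iota> \<circ> chi) (a + int d) = (\<iota> \<circ> chi) a" for a
    using assms(4) by (simp add: primitive_character_def dirichlet_character_def)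
  \<comment> \<open>Each of the six sums is an instance with \<open>u, v, w\<close> a permutation of
    the three weights. The three rewrite rules differ in which weight is the \<open>w\<close>
    bounding the power sum; \<open>u\<close> and \<open>v\<close> are matched freely.\<close>
  show ?thesis
    unfolding Let_def
      trinomial_sum_eq_gf[where chi = "\<iota> \<circ> chi", OF per \<open>odd d\<close> \<open>odd w1\<close>]
      trinomial_sum_eq_gf[where chi = "\<iota> \<circ> chi", OF per \<open>odd d\<close> \<open>odd w2\<close>]
      trinomial_sum_eq_gf[where chi = "\<iota> \<circ> chi", OF per \<open>odd d\<close> \<open>odd w3\<close>]
    by (simp only: mult_ac simp_thms)
qed

end
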